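(* Let $S$ be a finite commutative semigroup, let $E(S)$ be its set of idempotents, and for each $e\in E(S)$ let $A_e:=\{x\in S:\ x^k=e \text{ for some } k\ge 1\}$ be the corresponding Archimedean component. Then $S$ is a semilattice $Y$ of its Archimedean components $A_e$ $(e\in Y)$. That is, there is a meet-semilattice $Y$ with underlying set $E(S)$ such that $S$ is the disjoint union of the subsemigroups $A_e$ $(e\in Y)$, each $A_e$ being Archimedean, and $A_eA_f\subseteq A_{e\wedge f}$ for all $e,f\in Y$.
   Context: A semigroup is a set with an associative binary operation. For subsets $X,Z$ of a semigroup, $XZ:=\{xz:\ x\in X,\ z\in Z\}$. An idempotent is an element $e$ with $ee=e$. A finite commutative semigroup is called Archimedean if it has exactly one idempotent. A meet-semilattice is a poset in which any two elements $\alpha,\beta$ have a greatest common lower bound $\alpha\wedge\beta$. A semigroup $S$ is called an (ordinary) semilattice $Y$ of subsemigroups $S_\alpha$ $(\alpha\in Y)$ if $Y$ is a meet-semilattice, $S$ is the disjoint union of the subsemigroups $S_\alpha$ indexed by the elements of $Y$, and $S_\alpha S_\beta\subseteq S_{\alpha\wedge\beta}$ for all $\alpha,\beta\in Y$. *)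

theory Defs
  imports "HOL-Algebra.Lattice" "HOL-Library.Disjoint_Sets"
begin

locale semigroup_on =
  fixes S :: "'a set" and mult :: "'a \<Rightarrow> 'a \<Rightarrow> 'a"
  assumes closed: "\<lbrakk>x \<in> S; y \<in> S\<rbrakk> \<Longrightarrow> mult x y \<in> S"
    and assoc: "\<lbrakk>x \<in> S; y \<in> S; z \<in> S\<rbrakk> \<Longrightarrow> mult (mult x y) z = mult x (mult y z)"

locale finite_comm_semigroup_on = semigroup_on +
  assumes finite_carrier: "finite S"
    and comm: "\<lbrakk>x \<in> S; y \<in> S\<rbrakk> \<Longrightarrow> mult x y = mult y x"

definition subsemigroup_of :: "'a set \<Rightarrow> 'a set \<Rightarrow> ('a \<Rightarrow> 'a \<Rightarrow> 'a) \<Rightarrow> bool" where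
  "subsemigroup_of A S mult \<longleftrightarrow> A \<subseteq> S \<and> semigroup_on A mult"

definition set_product :: "('a \<Rightarrow> 'a \<Rightarrow> 'a) \<Rightarrow> 'a set \<Rightarrow> 'a set \<Rightarrow> 'a set" where
  "set_product mult X Z = {mult x z | x z. x \<in> X \<and> z \<in> Z}"

definition idempotents :: "'a set \<Rightarrow> ('a \<Rightarrow> 'a \<Rightarrow> 'a) \<Rightarrow> 'a set" where
  "idempotents S mult = {e \<in> S. mult e e = e}"

(* The power x^k for k >= 1. A semigroup has no identity, so the value at k = 0
   (which is x) carries no meaning and must be excluded at each use. *)
definition semigroup_power :: "('a \<Rightarrow> 'a \<Rightarrow> 'a) \<Rightarrow> 'a \<Rightarrow> nat \<Rightarrow> 'a" where
  "semigroup_power mult x k = (mult x ^^ (k - 1)) x"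

definition archimedean :: "'a set \<Rightarrow> ('a \<Rightarrow> 'a \<Rightarrow> 'a) \<Rightarrow> bool" where
  "archimedean S mult \<longleftrightarrow>
     finite_comm_semigroup_on S mult \<and> (\<exists>!e. e \<in> idempotents S mult)"

definition arch_component :: "'a set \<Rightarrow> ('a \<Rightarrow> 'a \<Rightarrow> 'a) \<Rightarrow> 'a \<Rightarrow> 'a set" where
  "arch_component S mult e = {x \<in> S. \<exists>k\<ge>1. semigroup_power mult x k = e}"

(* lower_semilattice forces the setoid equality .= of the gorder to be (=), so Y is an
   ordinary meet-semilattice with underlying set carrier Y. *)
definition semilattice_of_subsemigroups ::
  "'a set \<Rightarrow> ('a \<Rightarrow> 'a \<Rightarrow> 'a) \<Rightarrow> 'i gorder \<Rightarrow> ('i \<Rightarrow> 'a set) \<Rightarrow> bool" where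
  "semilattice_of_subsemigroups S mult Y A \<longleftrightarrow>
     lower_semilattice Y \<and>
     (\<forall>\<alpha>\<in>carrier Y. subsemigroup_of (A \<alpha>) S mult) \<and>
     disjoint_family_on A (carrier Y) \<and>
     (\<Union>\<alpha>\<in>carrier Y. A \<alpha>) = S \<and>
     (\<forall>\<alpha>\<in>carrier Y. \<forall>\<beta>\<in>carrier Y.
        set_product mult (A \<alpha>) (A \<beta>) \<subseteq> A (\<alpha> \<sqinter>\<^bsub>Y\<^esub> \<beta>))"

end

theory Submission
  imports Defs
begin

text \<open>
  Because \<open>S\<close> is finite, the powers of any \<open>x\<close> are eventually periodic, and an exponent that is
  both large and a multiple of the period yields an idempotent power
  (\<open>exists_idempotent_power\<close>). Two idempotent powers \<open>x\<^sup>m\<close> and \<open>x\<^sup>n\<close> both equal \<open>x\<^sup>m\<^sup>n\<close>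
  (\<open>idempotent_power_unique\<close>). Hence the components \<open>A\<^sub>e\<close> partition \<open>S\<close>.

  Commutativity gives \<open>(x y)\<^sup>n = x\<^sup>n y\<^sup>n\<close>. Thus idempotents are closed under multiplication, and if
  \<open>x\<^sup>m = e\<close> and \<open>y\<^sup>n = f\<close>, then \<open>(x y)\<^sup>m\<^sup>n = e f\<close>, that is \<open>A\<^sub>e A\<^sub>f \<subseteq> A\<^sub>e\<^sub>f\<close>
  (\<open>arch_component_mult\<close>). So it only remains to order \<open>E(S)\<close> in such a way that the product of
  idempotents is their meet. The order that does this is \<open>e \<le> f \<longleftrightarrow> e f = e\<close>.
  Everything else is the case \<open>e = f\<close>: each \<open>A\<^sub>e\<close> is a subsemigroup, and \<open>e\<close> is its only
  idempotent since an idempotent is its own only power.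
\<close>

section \<open>Powers in a semigroup\<close>

context semigroup_on
begin

abbreviation pow :: "'a \<Rightarrow> nat \<Rightarrow> 'a" where
  "pow \<equiv> semigroup_power mult"

lemma pow_one [simp]: "pow x (Suc 0) = x"
  by (simp add: semigroup_power_def)

lemma pow_Suc: "n \<ge> 1 \<Longrightarrow> pow x (Suc n) = mult x (pow x n)"
  by (cases n) (simp_all add: semigroup_power_def)

lemma pow_closed [simp]:
  assumes "x \<in> S"
  shows "pow x n \<in> S"
proof -
  have "(mult x ^^ k) x \<in> S" for k
    by (induction k) (simp_all add: assms closed)
  then show ?thesis by (simp add: semigroup_power_def)
qed

lemma pow_add:
  assumes x: "x \<in> S" and "m \<ge> 1" and n: "n \<ge> 1"
  shows "pow x (m + n) = mult (pow x m) (pow x n)"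
  using \<open>m \<ge> 1\<close>
proof (induction m rule: dec_induct)
  case base
  show ?case using n by (simp add: pow_Suc)
next
  case (step m)
  then show ?case using x n by (simp add: pow_Suc assoc)
qed

lemma pow_mult:
  assumes x: "x \<in> S" and m: "m \<ge> 1" and "n \<ge> 1"
  shows "pow x (m * n) = pow (pow x m) n"
  using \<open>n \<ge> 1\<close>
proof (induction n rule: dec_induct)
  case base
  show ?case by simp
next
  case (step n)
  have "pow x (m * Suc n) = mult (pow x m) (pow x (m * n))"
    using pow_add[OF x m, of "m * n"] m step.hyps by simp
  then show ?case using step by (simp add: pow_Suc)
qed

lemma idempotent_pow:
  assumes "e \<in> idempotents S mult" and "n \<ge> 1"
  shows "pow e n = e"
  using \<open>n \<ge> 1\<close>
  by (induction n rule: dec_induct)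
    (use assms(1) in \<open>simp_all add: pow_Suc idempotents_def\<close>)

lemma idempotent_power_unique:
  assumes x: "x \<in> S" and m: "m \<ge> 1" and n: "n \<ge> 1"
    and e: "pow x m \<in> idempotents S mult" and f: "pow x n \<in> idempotents S mult"
  shows "pow x m = pow x n"
proof -
  have "pow x m = pow x (m * n)"
    using pow_mult[OF x m n] idempotent_pow[OF e n] by simp
  also have "\<dots> = pow x n"
    using pow_mult[OF x n m] idempotent_pow[OF f m] by (simp add: mult.commute)
  finally show ?thesis .
qed

lemma pow_periodic:
  assumes x: "x \<in> S" and m: "m \<ge> 1" and period: "pow x (m + p) = pow x m" and "m \<le> n"
  shows "pow x (n + j * p) = pow x n"
proof (induction j)
  case 0
  show ?case by simp
next
  case (Suc j)
  have shift: "pow x (k + p) = pow x k" if "m \<le> k" for k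
    \<comment> \<open>The case split keeps the exponent \<open>k - m\<close> positive: there is no neutral zeroth power.\<close>
  proof (cases "k = m")
    case False
    with that have "k - m \<ge> 1" by simp
    have "pow x (k + p) = pow x ((m + p) + (k - m))" using that by (simp add: add.commute)
    also have "\<dots> = mult (pow x (m + p)) (pow x (k - m))"
      using pow_add[OF x _ \<open>k - m \<ge> 1\<close>, of "m + p"] m by simp
    also have "\<dots> = pow x (m + (k - m))"
      using pow_add[OF x m \<open>k - m \<ge> 1\<close>] period by simp
    finally show ?thesis using that by simp
  qed (use period in simp)
  have "pow x (n + Suc j * p) = pow x ((n + j * p) + p)" by (simp add: algebra_simps)
  also have "\<dots> = pow x n" using shift[of "n + j * p"] \<open>m \<le> n\<close> Suc by simp
  finally show ?case .
qed

text \<open>If the powers of \<open>x\<close> have period \<open>p\<close> from the exponent \<open>m\<close> on, then \<open>m * p\<close> is a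
  multiple of \<open>p\<close> lying in the periodic range, so doubling it does not change the power.\<close>

lemma exists_idempotent_power:
  assumes "finite S" and x: "x \<in> S"
  shows "\<exists>k\<ge>1. pow x k \<in> idempotents S mult"
proof -
  have "pow x ` {1..} \<subseteq> S" using x by auto
  then have "\<not> inj_on (pow x) {1..}"
    using \<open>finite S\<close> infinite_Ici finite_imageD finite_subset by metis
  then obtain a b where "a \<ge> 1" "b \<ge> 1" "a \<noteq> b" "pow x a = pow x b"
    by (auto simp: inj_on_def)
  then obtain m n where m: "m \<ge> 1" and "m < n" and "pow x n = pow x m"
    by (metis nat_neq_iff)
  define p where "p = n - m"
  have p: "p \<ge> 1" and period: "pow x (m + p) = pow x m"
    using \<open>m < n\<close> \<open>pow x n = pow x m\<close> by (simp_all add: p_def)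
  have mp: "m * p \<ge> 1" "m \<le> m * p" using m p by simp_all
  have "mult (pow x (m * p)) (pow x (m * p)) = pow x (m * p)"
    using pow_add[OF x mp(1) mp(1)] pow_periodic[OF x m period mp(2), of m] by simp
  then have "pow x (m * p) \<in> idempotents S mult" using x by (simp add: idempotents_def)
  with mp(1) show ?thesis by blast
qed

lemma idempotent_in_arch_component:
  "e \<in> idempotents S mult \<Longrightarrow> e \<in> arch_component S mult e"
  by (auto simp: arch_component_def idempotents_def intro!: exI[of _ "Suc 0"])

lemma idempotents_arch_component:
  assumes "e \<in> idempotents S mult"
  shows "idempotents (arch_component S mult e) mult = {e}"
proof -
  have "f = e" if "f \<in> idempotents (arch_component S mult e) mult" for f
  proof -
    from that have "f \<in> idempotents S mult" "f \<in> arch_component S mult e"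
      by (auto simp: idempotents_def arch_component_def)
    then show ?thesis using idempotent_pow by (auto simp: arch_component_def)
  qed
  moreover have "e \<in> idempotents (arch_component S mult e) mult"
    using idempotent_in_arch_component[OF assms] assms by (simp add: idempotents_def)
  ultimately show ?thesis by blast
qed

lemma disjoint_arch_components:
  "disjoint_family_on (arch_component S mult) (idempotents S mult)"
  unfolding disjoint_family_on_def arch_component_def
  using idempotent_power_unique by auto

lemma Union_arch_components:
  assumes "finite S"
  shows "(\<Union>e\<in>idempotents S mult. arch_component S mult e) = S"
  using exists_idempotent_power[OF assms] by (fastforce simp: arch_component_def)

end

section \<open>Products of Archimedean components\<close>

context finite_comm_semigroup_on
begin

lemma mult_mult_swap:
  assumes "a \<in> S" "b \<in> S" "c \<in> S" "d \<in> S"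
  shows "mult (mult a b) (mult c d) = mult (mult a c) (mult b d)"
  using assms by (metis assoc closed comm)

lemma pow_mult_distrib:
  assumes xy: "x \<in> S" "y \<in> S" and "n \<ge> 1"
  shows "pow (mult x y) n = mult (pow x n) (pow y n)"
  using \<open>n \<ge> 1\<close>
proof (induction n rule: dec_induct)
  case (step n)
  then show ?case using xy by (simp add: pow_Suc mult_mult_swap)
qed simp

lemma idempotents_mult_closed:
  assumes "e \<in> idempotents S mult" "f \<in> idempotents S mult"
  shows "mult e f \<in> idempotents S mult"
  using assms by (simp add: idempotents_def closed mult_mult_swap)

text \<open>The exponents that send \<open>x\<close> to \<open>e\<close> and \<open>y\<close> to \<open>f\<close> may differ, but their product serves
  both, because an idempotent is unchanged by taking further powers.\<close>

lemma arch_component_mult: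
  assumes e: "e \<in> idempotents S mult" and f: "f \<in> idempotents S mult"
    and "x \<in> arch_component S mult e" and "y \<in> arch_component S mult f"
  shows "mult x y \<in> arch_component S mult (mult e f)"
proof -
  obtain m n where x: "x \<in> S" "m \<ge> 1" "pow x m = e" and y: "y \<in> S" "n \<ge> 1" "pow y n = f"
    using assms(3,4) by (auto simp: arch_component_def)
  have mn: "m * n \<ge> 1" using x(2) y(2) by simp
  have "pow x (m * n) = e"
    using pow_mult[OF x(1,2) y(2)] x(3) idempotent_pow[OF e y(2)] by simp
  moreover have "pow y (m * n) = f"
    using pow_mult[OF y(1,2) x(2)] y(3) idempotent_pow[OF f x(2)] by (simp add: mult.commute)
  ultimately have "pow (mult x y) (m * n) = mult e f"
    using pow_mult_distrib[OF x(1) y(1) mn] by simp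
  with mn x(1) y(1) closed show ?thesis unfolding arch_component_def by blast
qed

lemma arch_component_comm_semigroup:
  assumes e: "e \<in> idempotents S mult"
  shows "finite_comm_semigroup_on (arch_component S mult e) mult"
proof -
  have sub: "arch_component S mult e \<subseteq> S" by (auto simp: arch_component_def)
  have "mult e e = e" using e by (simp add: idempotents_def)
  then have "mult x y \<in> arch_component S mult e"
    if "x \<in> arch_component S mult e" "y \<in> arch_component S mult e" for x y
    using arch_component_mult[OF e e that] by simp
  with sub show ?thesis
    by unfold_locales
      (simp add: subset_iff, meson assoc subsetD, meson finite_subset finite_carrier,
        meson comm subsetD)
qed

section \<open>The semilattice of idempotents\<close>

definition idempotent_order :: "'a gorder" where
  "idempotent_order =
     \<lparr>carrier = idempotents S mult, eq = (=), le = (\<lambda>e f. mult e f = e)\<rparr>"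

lemma carrier_idempotent_order [simp]: "carrier idempotent_order = idempotents S mult"
  by (simp add: idempotent_order_def)

lemma le_idempotent_order [simp]: "e \<sqsubseteq>\<^bsub>idempotent_order\<^esub> f \<longleftrightarrow> mult e f = e"
  by (simp add: idempotent_order_def)

lemma eq_idempotent_order [simp]: "e .=\<^bsub>idempotent_order\<^esub> f \<longleftrightarrow> e = f"
  by (simp add: idempotent_order_def)

lemma partial_order_idempotent_order: "partial_order idempotent_order"
proof
  fix x y z
  assume "x \<sqsubseteq>\<^bsub>idempotent_order\<^esub> y" "y \<sqsubseteq>\<^bsub>idempotent_order\<^esub> z"
    and "x \<in> carrier idempotent_order" "y \<in> carrier idempotent_order"
      "z \<in> carrier idempotent_order"
  then show "x \<sqsubseteq>\<^bsub>idempotent_order\<^esub> z" using assoc[of x y z] by (simp add: idempotents_def)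
qed (auto simp: idempotents_def comm fun_eq_iff)

lemma mult_is_glb:
  assumes e: "e \<in> idempotents S mult" and f: "f \<in> idempotents S mult"
  shows "is_glb idempotent_order (mult e f) {e, f}"
proof (rule greatest_LowerI)
  have eS: "e \<in> S" "mult e e = e" and fS: "f \<in> S" "mult f f = f"
    using e f by (simp_all add: idempotents_def)
  have "mult (mult e f) f = mult e f" using eS fS by (simp add: assoc)
  moreover have "mult (mult e f) e = mult e f"
    using eS fS by (metis assoc closed comm)
  ultimately show "x \<in> {e, f} \<Longrightarrow> mult e f \<sqsubseteq>\<^bsub>idempotent_order\<^esub> x" for x by auto
  show "g \<sqsubseteq>\<^bsub>idempotent_order\<^esub> mult e f" if "g \<in> Lower idempotent_order {e, f}" for g
  proof -
    from that have "g \<in> S" "mult g e = g" "mult g f = g"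
      using e f by (auto simp: Lower_def idempotents_def)
    then show ?thesis using eS fS assoc[of g e f] by simp
  qed
qed (use e f idempotents_mult_closed in simp_all)

lemma lower_semilattice_idempotent_order: "lower_semilattice idempotent_order"
proof -
  interpret partial_order idempotent_order by (rule partial_order_idempotent_order)
  show ?thesis by unfold_locales (use mult_is_glb in auto)
qed

lemma meet_idempotent_order:
  assumes "e \<in> idempotents S mult" "f \<in> idempotents S mult"
  shows "e \<sqinter>\<^bsub>idempotent_order\<^esub> f = mult e f"
proof -
  interpret lower_semilattice idempotent_order by (rule lower_semilattice_idempotent_order)
  have "is_glb idempotent_order (e \<sqinter>\<^bsub>idempotent_order\<^esub> f) {e, f}"
    using inf_of_two_greatest assms by (simp add: meet_def)
  then show ?thesis using greatest_unique mult_is_glb[OF assms] by blast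
qed

lemma semilattice_of_arch_components:
  "semilattice_of_subsemigroups S mult idempotent_order (arch_component S mult)"
proof -
  have "subsemigroup_of (arch_component S mult e) S mult" if "e \<in> idempotents S mult" for e
    using arch_component_comm_semigroup[OF that]
    by (auto simp: subsemigroup_of_def arch_component_def finite_comm_semigroup_on_def)
  moreover have "set_product mult (arch_component S mult e) (arch_component S mult f)
      \<subseteq> arch_component S mult (e \<sqinter>\<^bsub>idempotent_order\<^esub> f)"
    if "e \<in> idempotents S mult" "f \<in> idempotents S mult" for e f
    using arch_component_mult[OF that] meet_idempotent_order[OF that]
    by (auto simp: set_product_def)
  ultimately show ?thesis
    using lower_semilattice_idempotent_order disjoint_arch_components
      Union_arch_components[OF finite_carrier]
    by (simp add: semilattice_of_subsemigroups_def)
qed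

lemma archimedean_arch_component:
  "e \<in> idempotents S mult \<Longrightarrow> archimedean (arch_component S mult e) mult"
  using arch_component_comm_semigroup idempotents_arch_component
  by (simp add: archimedean_def)

end

theorem theorem9:
  fixes S :: "'a set" and mult :: "'a \<Rightarrow> 'a \<Rightarrow> 'a"
  assumes "finite_comm_semigroup_on S mult"
  shows "\<exists>Y :: 'a gorder.
           carrier Y = idempotents S mult \<and>
           semilattice_of_subsemigroups S mult Y (arch_component S mult) \<and>
           (\<forall>e\<in>carrier Y. archimedean (arch_component S mult e) mult)"
proof -
  interpret finite_comm_semigroup_on S mult by (rule assms)
  show ?thesis
    using semilattice_of_arch_components archimedean_arch_component
    by (intro exI[of _ idempotent_order]) simp
qed

end
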